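(* Let $\mathcal O$ be either $\mathbb CP^2$ or $\mathcal E$ and let $\boldsymbol p$ be a non trivial irreducible unitary representation of $SU(3)$ on $\mathcal H_{\boldsymbol p}$. No mapping-positive symbol correspondence $W:\mathcal B(\mathcal H_{\boldsymbol p})\to C^\infty_{\mathbb C}(\mathcal O)$ is Stratonovich-Weyl.
   Context: $\mathbb CP^2\simeq SU(3)/H$ with $H=\{\mathrm{diag}(\det(U)^{-1},U):U\in U(2)\}$, and $\mathcal E\simeq SU(3)/T$ is the full flag manifold, $T$ the diagonal maximal torus of $SU(3)$. Each has the $SU(3)$-invariant integral of total mass $1$, and $\langle f_1|f_2\rangle=\int_{\mathcal O}\overline{f_1}f_2\,d\boldsymbol\varsigma$. $\mathcal B(\mathcal H_{\boldsymbol p})$ carries the action $A^g=\rho(g)A\rho(g)^{-1}$, where $\rho$ is the irrep on $\mathcal H_{\boldsymbol p}$; $\dim(\boldsymbol p)=\dim\mathcal H_{\boldsymbol p}$; $\langle A_1|A_2\rangle_{\boldsymbol p}=\frac1{\dim(\boldsymbol p)}\operatorname{tr}(A_1^\dagger A_2)$. A symbol correspondence $W:\mathcal B(\mathcal H_{\boldsymbol p})\to C^\infty_{\mathbb C}(\mathcal O)$, $A\mapsto W_A$, is an injective linear map with: (1) $W_{A^g}=(W_A)^g$ for all $g\in SU(3)$, where $f^g(\boldsymbol\varsigma)=f(g^{-1}\boldsymbol\varsigma)$; (2) $W_{A^\dagger}=\overline{W_A}$; (3) $\int_{\mathcal O}W_A\,d\boldsymbol\varsigma=\operatorname{tr}(A)/\dim(\boldsymbol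 p)$. $W$ is mapping-positive if it maps positive (semidefinite) operators to functions that are $\ge0$ everywhere and positive-definite operators to functions that are $>0$ everywhere. $W$ is Stratonovich-Weyl if it is an isometry: $\langle W_{A_1}|W_{A_2}\rangle=\langle A_1|A_2\rangle_{\boldsymbol p}$ for all $A_1,A_2\in\mathcal B(\mathcal H_{\boldsymbol p})$. *)

theory Defs
  imports "HOL-Analysis.Analysis" "HOL-Probability.Probability_Measure" "HOL-Algebra.Left_Coset"
begin

section \<open>Operators on the Hilbert space \<open>\<complex>\<^sup>n\<close>\<close>

definition hermitian_adjoint :: "complex^'m^'n \<Rightarrow> complex^'n^'m" where
  "hermitian_adjoint A = map_matrix cnj (transpose A)"

definition herm_inner :: "complex^'n \<Rightarrow> complex^'n \<Rightarrow> complex" where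
  "herm_inner u v = (\<Sum>i\<in>UNIV. cnj (u $ i) * v $ i)"

text \<open>
  The order on \<open>complex\<close> is the one of \<^theory>\<open>HOL-Library.Complex_Order\<close>: \<open>0 \<le> z\<close> and \<open>0 < z\<close>
  say that \<open>z\<close> is real and nonnegative, respectively positive.
\<close>

definition positive_semidefinite :: "complex^'n^'n \<Rightarrow> bool" where
  "positive_semidefinite A \<longleftrightarrow> (\<forall>v. 0 \<le> herm_inner v (A *v v))"

definition positive_definite :: "complex^'n^'n \<Rightarrow> bool" where
  "positive_definite A \<longleftrightarrow> (\<forall>v. v \<noteq> 0 \<longrightarrow> 0 < herm_inner v (A *v v))"

definition operator_inner :: "complex^'n^'n \<Rightarrow> complex^'n^'n \<Rightarrow> complex" where
  "operator_inner A B = trace (hermitian_adjoint A ** B) / of_nat CARD('n)"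

section \<open>The groups and their representations\<close>

definition unitary_group :: "(complex^'n^'n) monoid" where
  "unitary_group = \<lparr>carrier = {A. hermitian_adjoint A ** A = mat 1 \<and> A ** hermitian_adjoint A = mat 1},
     mult = (**), one = mat 1\<rparr>"

definition SU3 :: "(complex^3^3) monoid" where
  "SU3 = \<lparr>carrier = {A \<in> carrier unitary_group. det A = 1}, mult = (**), one = mat 1\<rparr>"

definition unitary_representation :: "(complex^3^3 \<Rightarrow> complex^'n^'n) \<Rightarrow> bool" where
  "unitary_representation \<rho> \<longleftrightarrow> \<rho> \<in> hom SU3 unitary_group \<and> continuous_on (carrier SU3) \<rho>"

definition irreducible_representation :: "(complex^3^3 \<Rightarrow> complex^'n^'n) \<Rightarrow> bool" where
  "irreducible_representation \<rho> \<longleftrightarrow>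
     (\<forall>V. vec.subspace V \<and> (\<forall>g\<in>carrier SU3. \<forall>v\<in>V. \<rho> g *v v \<in> V) \<longrightarrow> V = {0} \<or> V = UNIV)"

definition trivial_representation :: "(complex^3^3 \<Rightarrow> complex^'n^'n) \<Rightarrow> bool" where
  "trivial_representation \<rho> \<longleftrightarrow> (\<forall>g\<in>carrier SU3. \<rho> g = mat 1)"

section \<open>The homogeneous spaces\<close>

text \<open>
  A homogeneous space \<open>SU(3)/K\<close> is the set \<open>lcosets\<^bsub>SU3\<^esub> K\<close> of left cosets, and \<open>g\<close> sends the coset
  \<open>\<sigma>\<close> to the coset \<open>g <#\<^bsub>SU3\<^esub> \<sigma>\<close>. Functions on \<open>SU(3)/K\<close> are HOL functions on sets of matrices
  of which only the values on \<open>lcosets\<^bsub>SU3\<^esub> K\<close> matter.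
\<close>

definition CP2_isotropy :: "(complex^3^3) set" where
  "CP2_isotropy = {vector [vector [inverse (det U), 0,         0        ],
                           vector [0,               U $ 1 $ 1, U $ 1 $ 2],
                           vector [0,               U $ 2 $ 1, U $ 2 $ 2]]
                   | U :: complex^2^2. U \<in> carrier unitary_group}"

definition diagonal_torus :: "(complex^3^3) set" where
  "diagonal_torus = {A \<in> carrier SU3. \<forall>i j. i \<noteq> j \<longrightarrow> A $ i $ j = 0}"

text \<open>
  The \<open>\<sigma>\<close>-algebra is the Borel algebra of the quotient topology on \<open>SU(3)/K\<close>. As \<open>SU(3)\<close> is compact
  and acts transitively, there is exactly one invariant probability measure.
\<close>

definition invariant_probability ::
    "(complex^3^3) set \<Rightarrow> (complex^3^3) set measure \<Rightarrow> bool" where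
  "invariant_probability K \<mu> \<longleftrightarrow>
     prob_space \<mu> \<and>
     space \<mu> = lcosets\<^bsub>SU3\<^esub> K \<and>
     sets \<mu> = sigma_sets (lcosets\<^bsub>SU3\<^esub> K)
       {U. U \<subseteq> lcosets\<^bsub>SU3\<^esub> K \<and>
           openin (top_of_set (carrier SU3)) {g \<in> carrier SU3. g <#\<^bsub>SU3\<^esub> K \<in> U}} \<and>
     (\<forall>g\<in>carrier SU3. \<forall>S\<in>sets \<mu>. emeasure \<mu> ((\<lambda>\<sigma>. g <#\<^bsub>SU3\<^esub> \<sigma>) ` S) = emeasure \<mu> S)"

definition function_inner ::
    "'a measure \<Rightarrow> ('a \<Rightarrow> complex) \<Rightarrow> ('a \<Rightarrow> complex) \<Rightarrow> complex" where
  "function_inner \<mu> f\<^sub>1 f\<^sub>2 = (LINT \<sigma>|\<mu>. cnj (f\<^sub>1 \<sigma>) * f\<^sub>2 \<sigma>)"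

subsection \<open>Smooth functions\<close>

text \<open>For open \<open>S\<close>, \<open>C_k_on k S f\<close> says that \<open>f\<close> is \<open>k\<close> times continuously differentiable on \<open>S\<close>.\<close>

primrec C_k_on ::
    "nat \<Rightarrow> 'a::real_normed_vector set \<Rightarrow> ('a \<Rightarrow> 'b::real_normed_vector) \<Rightarrow> bool" where
  "C_k_on 0 S f \<longleftrightarrow> continuous_on S f"
| "C_k_on (Suc k) S f \<longleftrightarrow>
     (\<forall>x\<in>S. f differentiable (at x)) \<and> (\<forall>v. C_k_on k S (\<lambda>x. frechet_derivative f (at x) v))"

text \<open>Smoothness on an embedded submanifold \<open>M\<close> is local extendability to smooth functions on the
  ambient space.\<close>

definition smooth_on_submanifold ::
    "'a::real_normed_vector set \<Rightarrow> ('a \<Rightarrow> 'b::real_normed_vector) \<Rightarrow> bool" where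
  "smooth_on_submanifold M f \<longleftrightarrow>
     (\<forall>x\<in>M. \<exists>U F. open U \<and> x \<in> U \<and> (\<forall>k. C_k_on k U F) \<and> (\<forall>y\<in>M \<inter> U. F y = f y))"

text \<open>The manifold structure of \<open>SU(3)/K\<close> is the one for which the projection \<open>g \<mapsto> gK\<close> is a
  submersion, so smooth functions are those whose pullback to \<open>SU(3)\<close> is smooth.\<close>

definition smooth_on_quotient :: "(complex^3^3) set \<Rightarrow> ((complex^3^3) set \<Rightarrow> complex) \<Rightarrow> bool" where
  "smooth_on_quotient K f \<longleftrightarrow> smooth_on_submanifold (carrier SU3) (\<lambda>g. f (g <#\<^bsub>SU3\<^esub> K))"

section \<open>Symbol correspondences\<close>

definition symbol_correspondence ::
    "(complex^3^3) set \<Rightarrow> (complex^3^3) set measure \<Rightarrow> (complex^3^3 \<Rightarrow> complex^'n^'n) \<Rightarrow>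
     (complex^'n^'n \<Rightarrow> (complex^3^3) set \<Rightarrow> complex) \<Rightarrow> bool" where
  "symbol_correspondence K \<mu> \<rho> W \<longleftrightarrow>
     (\<forall>A. smooth_on_quotient K (W A)) \<and>
     (\<forall>A B. \<forall>\<sigma>\<in>lcosets\<^bsub>SU3\<^esub> K. W (A + B) \<sigma> = W A \<sigma> + W B \<sigma>) \<and>
     (\<forall>c A. \<forall>\<sigma>\<in>lcosets\<^bsub>SU3\<^esub> K. W (map_matrix ((*) c) A) \<sigma> = c * W A \<sigma>) \<and>
     (\<forall>A B. (\<forall>\<sigma>\<in>lcosets\<^bsub>SU3\<^esub> K. W A \<sigma> = W B \<sigma>) \<longrightarrow> A = B) \<and>
     (\<forall>g\<in>carrier SU3. \<forall>A. \<forall>\<sigma>\<in>lcosets\<^bsub>SU3\<^esub> K.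
        W (\<rho> g ** A ** inv\<^bsub>unitary_group\<^esub> (\<rho> g)) \<sigma> = W A ((inv\<^bsub>SU3\<^esub> g) <#\<^bsub>SU3\<^esub> \<sigma>)) \<and>
     (\<forall>A. \<forall>\<sigma>\<in>lcosets\<^bsub>SU3\<^esub> K. W (hermitian_adjoint A) \<sigma> = cnj (W A \<sigma>)) \<and>
     (\<forall>A. (LINT \<sigma>|\<mu>. W A \<sigma>) = trace A / of_nat CARD('n))"

definition mapping_positive ::
    "(complex^3^3) set \<Rightarrow> (complex^'n^'n \<Rightarrow> (complex^3^3) set \<Rightarrow> complex) \<Rightarrow> bool" where
  "mapping_positive K W \<longleftrightarrow>
     (\<forall>A. positive_semidefinite A \<longrightarrow> (\<forall>\<sigma>\<in>lcosets\<^bsub>SU3\<^esub> K. 0 \<le> W A \<sigma>)) \<and>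
     (\<forall>A. positive_definite A \<longrightarrow> (\<forall>\<sigma>\<in>lcosets\<^bsub>SU3\<^esub> K. 0 < W A \<sigma>))"

definition Stratonovich_Weyl ::
    "(complex^3^3) set measure \<Rightarrow> (complex^'n^'n \<Rightarrow> (complex^3^3) set \<Rightarrow> complex) \<Rightarrow> bool" where
  "Stratonovich_Weyl \<mu> W \<longleftrightarrow> (\<forall>A\<^sub>1 A\<^sub>2. function_inner \<mu> (W A\<^sub>1) (W A\<^sub>2) = operator_inner A\<^sub>1 A\<^sub>2)"

end

theory Submission
  imports Defs
begin

text \<open>
  For an orthogonal projection \<open>P\<close>, positivity gives \<open>0 \<le> W\<^sub>P \<le> W\<^sub>1 = 1\<close>, while the isometry property
  and the normalisation give \<open>\<integral>W\<^sub>P\<^sup>2 = \<integral>W\<^sub>P\<close>; hence \<open>W\<^sub>P\<close> takes only the values 0 and 1 almost everywhere.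
  In dimension at least 2 this is contradictory: a linear functional with values in \<open>{0, 1}\<close>
  on all projections onto subspaces of a coordinate plane vanishes on them, as the lines through
  \<open>(3/5, 4/5)\<close> and \<open>(4/5, 3/5)\<close> already show, but \<open>\<integral>W\<^sub>P \<noteq> 0\<close>. In dimension 1 the representation
  is trivial because \<open>SU(3)\<close> is a perfect group.
\<close>


section \<open>Adjoints and the groups of unitary and special unitary matrices\<close>

lemma hermitian_adjoint_component [simp]: "hermitian_adjoint A $ i $ j = cnj (A $ j $ i)"
  by (simp add: hermitian_adjoint_def map_matrix_def transpose_def)

lemma hermitian_adjoint_mat_1 [simp]: "hermitian_adjoint (mat 1) = mat 1"
  by (simp add: vec_eq_iff mat_def)

lemma hermitian_adjoint_mult: "hermitian_adjoint (A ** B) = hermitian_adjoint B ** hermitian_adjoint A"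
  by (simp add: vec_eq_iff matrix_matrix_mult_def mult.commute)

lemma hermitian_adjoint_hermitian_adjoint [simp]: "hermitian_adjoint (hermitian_adjoint A) = A"
  by (simp add: vec_eq_iff)

lemma hermitian_adjoint_diff: "hermitian_adjoint (A - B) = hermitian_adjoint A - hermitian_adjoint B"
  by (simp add: vec_eq_iff)

lemma det_hermitian_adjoint: "det (hermitian_adjoint A) = cnj (det A)"
proof -
  have "det (map_matrix cnj B) = cnj (det B)" for B :: "complex^'a^'a"
    by (simp add: det_def map_matrix_def)
  then show ?thesis
    by (simp add: hermitian_adjoint_def)
qed

lemma group_unitary_group: "group (unitary_group :: (complex^'n^'n) monoid)"
proof (rule groupI)
  fix A B :: "complex^'n^'n"
  assume "A \<in> carrier unitary_group" "B \<in> carrier unitary_group"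
  then have A: "hermitian_adjoint A ** A = mat 1" "A ** hermitian_adjoint A = mat 1"
    and B: "hermitian_adjoint B ** B = mat 1" "B ** hermitian_adjoint B = mat 1"
    by (simp_all add: unitary_group_def)
  have "hermitian_adjoint (A ** B) ** (A ** B) = hermitian_adjoint B ** (hermitian_adjoint A ** A) ** B"
    "A ** B ** hermitian_adjoint (A ** B) = A ** (B ** hermitian_adjoint B) ** hermitian_adjoint A"
    by (simp_all add: hermitian_adjoint_mult matrix_mul_assoc)
  then show "A \<otimes>\<^bsub>unitary_group\<^esub> B \<in> carrier unitary_group"
    by (simp add: unitary_group_def A B)
next
  fix A :: "complex^'n^'n"
  assume "A \<in> carrier unitary_group"
  then show "\<exists>B\<in>carrier unitary_group. B \<otimes>\<^bsub>unitary_group\<^esub> A = \<one>\<^bsub>unitary_group\<^esub>"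
    by (auto simp: unitary_group_def intro!: exI[of _ "hermitian_adjoint A"])
qed (auto simp: unitary_group_def matrix_mul_assoc)

lemma group_SU3: "group SU3"
proof (rule groupI)
  interpret U: group "unitary_group :: (complex^3^3) monoid"
    by (rule group_unitary_group)
  fix A B :: "complex^3^3"
  assume "A \<in> carrier SU3" "B \<in> carrier SU3"
  then show "A \<otimes>\<^bsub>SU3\<^esub> B \<in> carrier SU3"
    using U.m_closed[of A B] by (simp add: SU3_def det_mul unitary_group_def)
next
  fix A :: "complex^3^3"
  assume "A \<in> carrier SU3"
  then show "\<exists>B\<in>carrier SU3. B \<otimes>\<^bsub>SU3\<^esub> A = \<one>\<^bsub>SU3\<^esub>"
    by (auto simp: SU3_def unitary_group_def det_hermitian_adjoint intro!: exI[of _ "hermitian_adjoint A"])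
qed (auto simp: SU3_def unitary_group_def matrix_mul_assoc)

section \<open>Orthogonal projections\<close>

definition orthogonal_projection :: "complex^'n^'n \<Rightarrow> bool" where
  "orthogonal_projection P \<longleftrightarrow> hermitian_adjoint P = P \<and> P ** P = P"

lemma orthogonal_projection_complement:
  fixes P :: "complex^'n^'n"
  assumes "orthogonal_projection P"
  shows "orthogonal_projection (mat 1 - P)"
proof -
  have "(A - B) ** C = A ** C - B ** C" "C ** (A - B) = C ** A - C ** B" for A B C :: "complex^'n^'n"
    by (simp_all add: matrix_matrix_mult_def vec_eq_iff left_diff_distrib right_diff_distrib sum_subtractf)
  with assms show ?thesis
    by (simp add: orthogonal_projection_def hermitian_adjoint_diff)
qed

lemma herm_inner_adjoint: "herm_inner v (A *v w) = herm_inner (hermitian_adjoint A *v v) w"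
  unfolding herm_inner_def matrix_vector_mult_def
  by (simp add: sum_distrib_left sum_distrib_right mult_ac, subst sum.swap, rule refl)

lemma orthogonal_projection_positive_semidefinite:
  assumes "orthogonal_projection P"
  shows "positive_semidefinite P"
  unfolding positive_semidefinite_def
proof
  fix v
  have "herm_inner v (P *v v) = herm_inner v (P *v (P *v v))"
    using assms by (simp add: orthogonal_projection_def matrix_vector_mul_assoc)
  also have "\<dots> = herm_inner (P *v v) (P *v v)"
    using assms by (simp add: herm_inner_adjoint orthogonal_projection_def)
  also have "\<dots> \<ge> 0"
    unfolding herm_inner_def by (intro sum_nonneg) (simp add: less_eq_complex_def)
  finally show "0 \<le> herm_inner v (P *v v)" .
qed

text \<open>For distinct i, j and a^2 + b^2 = 1 this is the orthogonal projection onto the line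
  through a e_i + b e_j. The coefficients are real, so the outer product needs no conjugate.\<close>

definition plane_projection :: "'n \<Rightarrow> 'n \<Rightarrow> real \<Rightarrow> real \<Rightarrow> complex^'n^'n" where
  "plane_projection i j a b =
     (let u = (\<lambda>k. of_real (if k = i then a else if k = j then b else 0))
      in (\<chi> r c. u r * u c))"

lemma orthogonal_projection_plane_projection:
  fixes i j :: "'n::finite"
  assumes "i \<noteq> j" "a\<^sup>2 + b\<^sup>2 = 1"
  shows "orthogonal_projection (plane_projection i j a b)"
proof -
  define u :: "'n \<Rightarrow> complex" where
    "u = (\<lambda>k. of_real (if k = i then a else if k = j then b else 0))"
  have "(\<Sum>k\<in>UNIV. u k * u k) = (\<Sum>k\<in>{i, j}. u k * u k)"
    by (rule sum.mono_neutral_right) (auto simp: u_def)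
  also have "\<dots> = of_real (a\<^sup>2 + b\<^sup>2)"
    using assms(1) by (simp add: u_def power2_eq_square)
  finally have *: "(\<Sum>k\<in>UNIV. u k * u k) = 1"
    using assms(2) by simp
  have "(\<Sum>k\<in>UNIV. u r * u k * (u k * u c)) = u r * u c" for r c
  proof -
    have "(\<Sum>k\<in>UNIV. u r * u k * (u k * u c)) = u r * u c * (\<Sum>k\<in>UNIV. u k * u k)"
      by (simp add: sum_distrib_left mult_ac)
    then show ?thesis
      by (simp add: *)
  qed
  moreover have "plane_projection i j a b = (\<chi> r c. u r * u c)"
    by (simp add: plane_projection_def u_def Let_def)
  ultimately show ?thesis
    by (simp add: orthogonal_projection_def vec_eq_iff matrix_matrix_mult_def)
      (simp add: u_def)
qed

text \<open>Projections onto orthogonal lines add up to a projection; here the sum is diagonal with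
  entries 0 and 1. It serves to exclude that both axis symbols equal 1.\<close>

lemma orthogonal_projection_coordinate_plane:
  fixes i j :: "'n::finite"
  assumes "i \<noteq> j"
  shows "orthogonal_projection (plane_projection i j 1 0 + plane_projection i j 0 1)"
proof -
  define d :: "'n \<Rightarrow> complex" where "d k = (if k = i \<or> k = j then 1 else 0)" for k
  have "plane_projection i j 1 0 + plane_projection i j 0 1 = (\<chi> r c. if r = c then d r else 0)"
    using assms by (auto simp: plane_projection_def vec_eq_iff d_def)
  moreover have "(\<Sum>k\<in>UNIV. (if r = k then d r else 0) * (if k = c then d k else 0))
      = (if r = c then d r else 0)" for r c
  proof -
    have "(\<Sum>k\<in>UNIV. (if r = k then d r else 0) * (if k = c then d k else 0))
        = (\<Sum>k\<in>UNIV. if r = k then d r * (if r = c then d r else 0) else 0)"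
      by (rule sum.cong) simp_all
    then show ?thesis
      by (simp add: d_def)
  qed
  ultimately show ?thesis
    by (simp add: orthogonal_projection_def vec_eq_iff matrix_matrix_mult_def) (simp add: d_def)
qed

text \<open>The two unit vectors are mirror images, so their projections share the off-diagonal
  entry 12/25, and their diagonal entries differ by 16/25 - 9/25 = 7/25 with opposite signs.\<close>

lemma plane_projection_rotate:
  assumes "i \<noteq> j"
  shows "plane_projection i j (4/5) (3/5) + map_matrix ((*) (7/25)) (plane_projection i j 0 1)
    = plane_projection i j (3/5) (4/5) + map_matrix ((*) (7/25)) (plane_projection i j 1 0)"
  using assms by (auto simp: plane_projection_def vec_eq_iff map_matrix_def)

section \<open>Symbols of projections\<close>

text \<open>Conjugation fixes the identity, so equivariance makes its symbol constant under the
  transitive action of SU(3). The trace normalisation on a probability space determines the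
  constant.\<close>

lemma symbol_mat_1:
  assumes "invariant_probability K \<mu>" "unitary_representation \<rho>"
    "symbol_correspondence K \<mu> (\<rho> :: complex^3^3 \<Rightarrow> complex^'n^'n) W"
    "\<sigma> \<in> lcosets\<^bsub>SU3\<^esub> K"
  shows "W (mat 1) \<sigma> = 1"
proof -
  interpret S: group SU3 by (rule group_SU3)
  interpret U: group "unitary_group :: (complex^'n^'n) monoid" by (rule group_unitary_group)
  interpret prob_space \<mu> using assms(1) by (simp add: invariant_probability_def)
  have base: "W (mat 1) \<tau> = W (mat 1) K" if \<tau>: "\<tau> \<in> lcosets\<^bsub>SU3\<^esub> K" for \<tau>
  proof -
    obtain g where g: "g \<in> carrier SU3" "\<tau> = g <#\<^bsub>SU3\<^esub> K"
      using \<tau> by (auto simp: LCOSETS_def)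
    have "\<rho> g \<in> carrier unitary_group"
      using assms(2) g by (auto simp: unitary_representation_def hom_def)
    then have "\<rho> g ** mat 1 ** inv\<^bsub>unitary_group\<^esub> (\<rho> g) = mat 1"
      using U.r_inv[of "\<rho> g"] by (simp add: unitary_group_def)
    moreover have "(inv\<^bsub>SU3\<^esub> g) <#\<^bsub>SU3\<^esub> \<tau> = K"
    proof -
      have "inv\<^bsub>SU3\<^esub> g ** g = mat 1"
        using S.l_inv[OF g(1)] by (simp add: SU3_def)
      then show ?thesis
        by (simp add: g(2) l_coset_def) (simp add: SU3_def matrix_mul_assoc)
    qed
    ultimately show ?thesis
      using assms(3) g(1) \<tau> unfolding symbol_correspondence_def by metis
  qed
  have "(LINT \<tau>|\<mu>. W (mat 1) \<tau>) = (LINT \<tau>|\<mu>. W (mat 1) K)"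
    using assms(1) by (intro Bochner_Integration.integral_cong) (auto simp: invariant_probability_def base)
  moreover have "(LINT \<tau>|\<mu>. W (mat 1) \<tau>) = 1"
    using assms(3) by (simp add: symbol_correspondence_def trace_I)
  ultimately show ?thesis
    using base[OF assms(4)] by (simp add: prob_space)
qed

lemma AE_symbol_projection:
  fixes P :: "complex^'n^'n"
  assumes "invariant_probability K \<mu>" "unitary_representation \<rho>" "symbol_correspondence K \<mu> \<rho> W"
    "mapping_positive K W" "Stratonovich_Weyl \<mu> W" "orthogonal_projection P" "trace P \<noteq> 0"
  shows "AE \<sigma> in \<mu>. W P \<sigma> = 0 \<or> W P \<sigma> = 1"
proof -
  have sp: "space \<mu> = lcosets\<^bsub>SU3\<^esub> K"
    using assms(1) by (simp add: invariant_probability_def)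
  \<comment> \<open>The symbols of P and 1 - P are nonnegative and sum to 1. In the order on
    \<open>complex\<close> this also makes them real.\<close>
  have range: "0 \<le> W P \<sigma> \<and> W P \<sigma> \<le> 1" if "\<sigma> \<in> space \<mu>" for \<sigma>
  proof -
    have "W P \<sigma> + W (mat 1 - P) \<sigma> = W (P + (mat 1 - P)) \<sigma>"
      using that assms(3) unfolding sp symbol_correspondence_def by (elim conjE) metis
    also have "\<dots> = 1"
      using symbol_mat_1[OF assms(1-3)] that sp by simp
    finally have "W P \<sigma> + W (mat 1 - P) \<sigma> = 1" .
    moreover have "0 \<le> W P \<sigma>" "0 \<le> W (mat 1 - P) \<sigma>"
      using assms(4,6) that orthogonal_projection_complement orthogonal_projection_positive_semidefinite
      unfolding sp mapping_positive_def by blast+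
    ultimately show ?thesis
      by (metis le_add_same_cancel1)
  qed
  have I1: "(LINT \<sigma>|\<mu>. W P \<sigma>) = trace P / of_nat CARD('n)"
    using assms(3) by (simp add: symbol_correspondence_def)
  have I2: "(LINT \<sigma>|\<mu>. cnj (W P \<sigma>) * W P \<sigma>) = trace P / of_nat CARD('n)"
    using assms(5,6)
    by (simp add: Stratonovich_Weyl_def function_inner_def operator_inner_def orthogonal_projection_def)
  \<comment> \<open>A non-integrable function has Bochner integral 0 by convention, so the nonzero
    trace forces integrability.\<close>
  have i1: "integrable \<mu> (W P)"
    by (rule ccontr) (use I1 assms(7) in \<open>simp add: not_integrable_integral_eq\<close>)
  have i2: "integrable \<mu> (\<lambda>\<sigma>. cnj (W P \<sigma>) * W P \<sigma>)"
    by (rule ccontr) (use I2 assms(7) in \<open>simp add: not_integrable_integral_eq\<close>)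
  \<comment> \<open>For a real value w in [0, 1] this is w - w^2, which is nonnegative and vanishes
    only at 0 and 1. Its integral is 0 because P is both self-adjoint and idempotent.\<close>
  define h where "h \<sigma> = Re (W P \<sigma> - cnj (W P \<sigma>) * W P \<sigma>)" for \<sigma>
  have h: "h \<sigma> = Re (W P \<sigma>) * (1 - Re (W P \<sigma>)) \<and> Im (W P \<sigma>) = 0" if "\<sigma> \<in> space \<mu>" for \<sigma>
    using range[OF that] by (simp add: h_def less_eq_complex_def algebra_simps)
  have ih: "integrable \<mu> h"
    unfolding h_def using i1 i2 by (intro integrable_Re Bochner_Integration.integrable_diff)
  have "integral\<^sup>L \<mu> h = 0"
    unfolding h_def using i1 i2 I1 I2 by (subst integral_Re) simp_all
  moreover have "AE \<sigma> in \<mu>. 0 \<le> h \<sigma>"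
    using range h by (intro AE_I2) (simp add: less_eq_complex_def)
  ultimately have "AE \<sigma> in \<mu>. h \<sigma> = 0"
    using integral_nonneg_eq_0_iff_AE[OF ih] by simp
  then show ?thesis
    using AE_space by eventually_elim (use h in \<open>auto simp: complex_eq_iff\<close>)
qed

lemma Stratonovich_Weyl_positive_dim_1:
  fixes \<rho> :: "complex^3^3 \<Rightarrow> complex^'n^'n"
  assumes "invariant_probability K \<mu>" "unitary_representation \<rho>" "symbol_correspondence K \<mu> \<rho> W"
    "mapping_positive K W" "Stratonovich_Weyl \<mu> W"
  shows "CARD('n) = 1"
proof (rule ccontr)
  assume "CARD('n) \<noteq> 1"
  then obtain i j :: 'n where ij: "i \<noteq> j"
    by (metis is_singletonI' is_singleton_altdef empty_not_UNIV)
  have sp: "space \<mu> = lcosets\<^bsub>SU3\<^esub> K"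
    using assms(1) by (simp add: invariant_probability_def)
  have add: "W (A + B) \<sigma> = W A \<sigma> + W B \<sigma>" if "\<sigma> \<in> space \<mu>" for A B \<sigma>
    using that assms(3) unfolding sp symbol_correspondence_def by simp
  have scale: "W (map_matrix ((*) c) A) \<sigma> = c * W A \<sigma>" if "\<sigma> \<in> space \<mu>" for c A \<sigma>
    using that assms(3) unfolding sp symbol_correspondence_def by simp
  let ?P = "plane_projection i j :: real \<Rightarrow> real \<Rightarrow> complex^'n^'n"
  have tr: "trace (?P a b) = of_real (a\<^sup>2 + b\<^sup>2)" for a b
  proof -
    have "trace (?P a b) = (\<Sum>k\<in>{i, j}. ?P a b $ k $ k)"
      unfolding trace_def by (rule sum.mono_neutral_right) (auto simp: plane_projection_def)
    also have "\<dots> = of_real (a\<^sup>2 + b\<^sup>2)"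
      using ij by (simp add: plane_projection_def power2_eq_square)
    finally show ?thesis .
  qed
  note AE = AE_symbol_projection[OF assms]
  have P: "AE \<sigma> in \<mu>. W (?P a b) \<sigma> = 0 \<or> W (?P a b) \<sigma> = 1" if "a\<^sup>2 + b\<^sup>2 = 1" for a b
    using that by (intro AE orthogonal_projection_plane_projection ij) (simp_all add: tr)
  have Q: "AE \<sigma> in \<mu>. W (?P 1 0 + ?P 0 1) \<sigma> = 0 \<or> W (?P 1 0 + ?P 0 1) \<sigma> = 1"
    by (intro AE orthogonal_projection_coordinate_plane ij) (simp add: trace_add tr)
  \<comment> \<open>Let p, q be the symbols of the axis projections and s, s' those of the lines
    through (4/5, 3/5) and (3/5, 4/5), all 0 or 1. Then s - s' = 7/25 (p - q) forces p = q, and p +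
    q is 0 or 1, so p = 0.\<close>
  have "AE \<sigma> in \<mu>. W (?P 1 0) \<sigma> = 0"
    using P[of 1 0, simplified] P[of 0 1, simplified] Q AE_space
      P[of "3/5" "4/5", simplified power2_eq_square, simplified]
      P[of "4/5" "3/5", simplified power2_eq_square, simplified]
  proof eventually_elim
    case (elim \<sigma>)
    have "W (?P (4/5) (3/5)) \<sigma> + 7/25 * W (?P 0 1) \<sigma> = W (?P (3/5) (4/5)) \<sigma> + 7/25 * W (?P 1 0) \<sigma>"
      using arg_cong[OF plane_projection_rotate[OF ij], of "\<lambda>A. W A \<sigma>"] elim(4)
      by (simp add: add scale)
    with elim show ?case
      by (auto simp: add complex_eq_iff)
  qed
  then have "(LINT \<sigma>|\<mu>. W (?P 1 0) \<sigma>) = 0"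
    by (rule integral_eq_zero_AE)
  \<comment> \<open>The same integral is the normalised trace of a rank-one projection, which is not
    0.\<close>
  then show False
    using assms(3) by (simp add: symbol_correspondence_def tr)
qed

section \<open>Characters of SU(3)\<close>

text \<open>The pair (a, b) stands for the quaternion a + b j. The second row (-b, a) of the block
  sends a column (x, y) to a y - b x, the quantity that the Givens rotations annihilate.\<close>

definition SU2_lower :: "complex \<Rightarrow> complex \<Rightarrow> complex^3^3" where
  "SU2_lower a b = vector [vector [1, 0, 0], vector [0, cnj a, cnj b], vector [0, - b, a]]"

definition SU2_upper :: "complex \<Rightarrow> complex \<Rightarrow> complex^3^3" where
  "SU2_upper a b = vector [vector [cnj a, cnj b, 0], vector [- b, a, 0], vector [0, 0, 1]]"

section \<open>Unit quaternions inside SU(3)\<close>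

lemmas matrix3_simps = vec_eq_iff forall_3 matrix_matrix_mult_def sum_3 mat_def

lemma unit_complex_pair:
  fixes a b :: complex
  shows "(cmod a)\<^sup>2 + (cmod b)\<^sup>2 = 1 \<longleftrightarrow> a * cnj a + b * cnj b = 1"
proof -
  have "a * cnj a + b * cnj b = of_real ((cmod a)\<^sup>2 + (cmod b)\<^sup>2)"
    by (simp only: of_real_add complex_norm_square)
  then show ?thesis
    by (simp only: of_real_eq_1_iff)
qed

text \<open>Both embeddings follow the quaternion product (a + b j)(c + d j), so each later identity
  is checked once on pairs.\<close>

lemma SU2_mult:
  "SU2_lower a b ** SU2_lower c d = SU2_lower (a * c - b * cnj d) (b * cnj c + a * d)"
  "SU2_upper a b ** SU2_upper c d = SU2_upper (a * c - b * cnj d) (b * cnj c + a * d)"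
  by (simp_all add: SU2_lower_def SU2_upper_def matrix3_simps algebra_simps)

lemma SU2_adjoint:
  "hermitian_adjoint (SU2_lower a b) = SU2_lower (cnj a) (- b)"
  "hermitian_adjoint (SU2_upper a b) = SU2_upper (cnj a) (- b)"
  by (simp_all add: SU2_lower_def SU2_upper_def vec_eq_iff forall_3)

lemma SU2_1: "SU2_lower 1 0 = mat 1" "SU2_upper 1 0 = mat 1"
  by (simp_all add: SU2_lower_def SU2_upper_def matrix3_simps)

lemma SU2_in_SU3:
  assumes "a * cnj a + b * cnj b = 1"
  shows "SU2_lower a b \<in> carrier SU3" "SU2_upper a b \<in> carrier SU3"
proof -
  have "det (SU2_lower a b) = 1" "det (SU2_upper a b) = 1"
    using assms by (simp_all add: SU2_lower_def SU2_upper_def det_3 mult.commute)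
  then show "SU2_lower a b \<in> carrier SU3" "SU2_upper a b \<in> carrier SU3"
    using assms by (simp_all add: SU3_def unitary_group_def SU2_adjoint SU2_mult SU2_1 mult.commute)
qed

text \<open>Unit quaternions have unit square roots: for \<open>x \<noteq> -1\<close> normalise \<open>x + 1\<close>.\<close>

lemma SU2_square_root:
  assumes "a * cnj a + b * cnj b = 1"
  obtains c d where "c * cnj c + d * cnj d = 1" "c * c - d * cnj d = a" "d * cnj c + c * d = b"
proof (cases "Re a = - 1")
  case True
  have "(cmod a)\<^sup>2 + (cmod b)\<^sup>2 = 1"
    using assms unit_complex_pair by blast
  then have "Im a = 0" "b = 0"
    using True by (auto simp: cmod_power2 complex_eq_iff add_nonneg_eq_0_iff sum_power2_eq_zero_iff)
  with True have "a = - 1" "b = 0"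
    by (auto simp: complex_eq_iff)
  \<comment> \<open>The quaternion -1 has the square root j.\<close>
  then show ?thesis
    using that[of 0 1] by simp
next
  case False
  \<comment> \<open>For a unit quaternion x = a + b j, t is the squared norm of x + 1, and also (x +
    1)^2 = t x.\<close>
  define t where "t = a + cnj a + 2"
  have t: "t = of_real (2 * Re a + 2)"
    by (simp add: t_def complex_add_cnj)
  have "(cmod a)\<^sup>2 + (cmod b)\<^sup>2 = 1"
    using assms unit_complex_pair by blast
  then have "(cmod a)\<^sup>2 \<le> 1\<^sup>2"
    using zero_le_power2[of "cmod b"] unfolding one_power2 by linarith
  then have "cmod a \<le> 1"
    by (rule power2_le_imp_le) simp
  then have pos: "2 * Re a + 2 > 0"
    using abs_Re_le_cmod[of a] False by linarith
  define r :: complex where "r = of_real (sqrt (2 * Re a + 2))"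
  have r: "r * r = t" "cnj r = r" "r \<noteq> 0"
    using pos by (simp_all add: r_def t flip: of_real_mult)
  then have "t \<noteq> 0"
    by auto
  note r = r this
  have bb: "b * cnj b = 1 - a * cnj a"
    using assms by (simp add: algebra_simps)
  show ?thesis
  proof (rule that[of "(a + 1) / r" "b / r"])
    have "(a + 1) * (cnj a + 1) + b * cnj b = t"
      unfolding bb by (simp add: t_def algebra_simps)
    then show "(a + 1) / r * cnj ((a + 1) / r) + b / r * cnj (b / r) = 1"
      using r by (simp flip: add_divide_distrib)
    have "(a + 1) * (a + 1) - b * cnj b = a * t"
      unfolding bb by (simp add: t_def algebra_simps)
    then show "(a + 1) / r * ((a + 1) / r) - b / r * cnj (b / r) = a"
      using r by (simp flip: diff_divide_distrib)
    have "b * (cnj a + 1) + (a + 1) * b = b * t"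
      by (simp add: t_def algebra_simps)
    then show "b / r * cnj ((a + 1) / r) + (a + 1) / r * (b / r) = b"
      using r by (simp flip: add_divide_distrib)
  qed
qed

text \<open>The second equation says Re (b * cnj u) = 0: the pure quaternions b j and u j are
  orthogonal, hence anticommute. For nonzero b, a quarter turn of b / |b| does this.\<close>

lemma SU2_anticommuting:
  obtains u where "u * cnj u = 1" "b * cnj u + u * cnj b = 0"
proof (cases "b = 0")
  case True
  then show ?thesis using that[of 1] by simp
next
  case False
  show ?thesis
    by (rule that[of "\<i> * b / of_real (cmod b)"])
      (use False in \<open>simp_all add: field_simps flip: complex_norm_square power2_eq_square\<close>)
qed

text \<open>The quaternion J = u j anticommutes with the imaginary part of the unit quaternion X = c
  + d j, so J X = X^-1 J, and therefore X J X = J.\<close>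

lemma SU2_inverting:
  assumes "c * cnj c + d * cnj d = 1" "d * cnj u + u * cnj d = 0"
  shows "SU2_lower c d ** SU2_lower 0 u ** SU2_lower c d = SU2_lower 0 u"
    "SU2_upper c d ** SU2_upper 0 u ** SU2_upper c d = SU2_upper 0 u"
proof -
  have "- (d * cnj u) * c - c * u * cnj d = - c * (d * cnj u + u * cnj d)"
    by (simp add: algebra_simps)
  then have 1: "- (d * cnj u) * c - c * u * cnj d = 0"
    using assms(2) by simp
  have "c * u * cnj c + - (d * cnj u) * d = u * (c * cnj c + d * cnj d) - d * (d * cnj u + u * cnj d)"
    by (simp add: algebra_simps)
  then have 2: "c * u * cnj c + - (d * cnj u) * d = u"
    using assms by simp
  show "SU2_lower c d ** SU2_lower 0 u ** SU2_lower c d = SU2_lower 0 u"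
    "SU2_upper c d ** SU2_upper 0 u ** SU2_upper c d = SU2_upper 0 u"
    using 1 2 by (simp_all add: SU2_mult)
qed

section \<open>Givens reduction to the diagonal torus\<close>

lemma SU2_rotate_to_axis:
  fixes x y :: complex
  obtains a b where "a * cnj a + b * cnj b = 1" "a * y = b * x"
proof (cases "x = 0 \<and> y = 0")
  case True
  then show ?thesis using that[of 1 0] by simp
next
  case False
  \<comment> \<open>The rotation is (x, y) divided by its norm r; the equation a y = b x only says
    that (a, b) is proportional to (x, y).\<close>
  define r :: complex where "r = of_real (sqrt ((cmod x)\<^sup>2 + (cmod y)\<^sup>2))"
  have pos: "(cmod x)\<^sup>2 + (cmod y)\<^sup>2 > 0"
    using False by (auto simp: sum_power2_gt_zero_iff)
  then have "r * r = of_real ((cmod x)\<^sup>2 + (cmod y)\<^sup>2)"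
    unfolding r_def by (simp only: flip: of_real_mult) simp
  then have "r * r = x * cnj x + y * cnj y"
    by (simp only: of_real_add complex_norm_square)
  moreover have "cnj r = r" "r \<noteq> 0"
    using False by (auto simp: r_def)
  ultimately have r: "r * r = x * cnj x + y * cnj y" "cnj r = r" "r \<noteq> 0" "x * cnj x + y * cnj y \<noteq> 0"
    by (auto simp flip: \<open>r * r = x * cnj x + y * cnj y\<close>)
  show ?thesis
    by (rule that[of "x / r" "y / r"])
      (use r in \<open>simp_all add: mult.commute flip: add_divide_distrib\<close>)
qed

text \<open>Orthonormality of the columns makes an upper triangular unitary matrix diagonal. The two
  factors supply the corner entries, and determinant 1 then makes the middle entries agree.\<close>

lemma upper_triangular_SU3:
  assumes "A \<in> carrier SU3" "A $ 2 $ 1 = 0" "A $ 3 $ 1 = 0" "A $ 3 $ 2 = 0"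
  obtains a b where "a * cnj a = 1" "b * cnj b = 1" "A = SU2_upper a 0 ** SU2_lower b 0"
proof -
  have U: "(hermitian_adjoint A ** A) $ i $ j = mat 1 $ i $ j" for i j
    using assms(1) by (simp add: SU3_def unitary_group_def)
  have d: "A $ 1 $ 1 * A $ 2 $ 2 * A $ 3 $ 3 = 1"
    using assms by (simp add: SU3_def det_3)
  have 11: "cnj (A $ 1 $ 1) * A $ 1 $ 1 = 1"
    using U[of 1 1] assms by (simp add: matrix3_simps)
  then have nz: "A $ 1 $ 1 \<noteq> 0" by auto
  have 12: "A $ 1 $ 2 = 0" and 13: "A $ 1 $ 3 = 0"
    using U[of 1 2] U[of 1 3] assms nz by (simp_all add: matrix3_simps)
  have 22: "cnj (A $ 2 $ 2) * A $ 2 $ 2 = 1"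
    using U[of 2 2] assms 12 by (simp add: matrix3_simps)
  then have nz2: "A $ 2 $ 2 \<noteq> 0" by auto
  have 23: "A $ 2 $ 3 = 0"
    using U[of 2 3] assms 12 nz2 by (simp add: matrix3_simps)
  have 33: "cnj (A $ 3 $ 3) * A $ 3 $ 3 = 1"
    using U[of 3 3] 13 23 by (simp add: matrix3_simps)
  have e: "cnj (A $ 1 $ 1) * cnj (A $ 3 $ 3) = A $ 2 $ 2"
  proof -
    have "cnj (A $ 1 $ 1) * cnj (A $ 3 $ 3)
        = cnj (A $ 1 $ 1) * cnj (A $ 3 $ 3) * (A $ 1 $ 1 * A $ 2 $ 2 * A $ 3 $ 3)"
      by (simp add: d)
    also have "\<dots> = (cnj (A $ 1 $ 1) * A $ 1 $ 1) * (cnj (A $ 3 $ 3) * A $ 3 $ 3) * A $ 2 $ 2"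
      by (simp only: mult_ac)
    finally show ?thesis using 11 33 by simp
  qed
  have "A = SU2_upper (cnj (A $ 1 $ 1)) 0 ** SU2_lower (A $ 3 $ 3) 0"
    using assms 12 13 23 e by (simp add: SU2_upper_def SU2_lower_def matrix3_simps)
  then show ?thesis
    using that[of "cnj (A $ 1 $ 1)" "A $ 3 $ 3"] 11 33 by (simp add: mult.commute)
qed

section \<open>One-dimensional representations\<close>

lemma matrix_mult_commute_dim_1:
  fixes A B :: "'a::comm_semiring_1^'n^'n"
  assumes "CARD('n) = 1"
  shows "A ** B = B ** A"
proof -
  obtain a :: 'n where "UNIV = {a}"
    using assms card_1_singletonE by blast
  then have eq: "i = a" for i
    by blast
  have sum: "sum f UNIV = f a" for f :: "'n \<Rightarrow> 'a"
    unfolding \<open>UNIV = {a}\<close> by simp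
  have "(A ** B) $ i $ j = (B ** A) $ i $ j" for i j
    using eq[of i] eq[of j] by (simp add: matrix_matrix_mult_def sum mult.commute)
  then show ?thesis
    by (simp add: vec_eq_iff)
qed

text \<open>
  The relation \<open>X J X = J\<close> makes \<open>X\<^sup>2\<close> the commutator of \<open>X\<close> and \<open>J\<close>, and Givens rotations from the
  two embedded copies of \<open>SU(2)\<close> reduce every element of \<open>SU(3)\<close> to the torus.
\<close>

lemma dim_1_representation_trivial:
  fixes \<rho> :: "complex^3^3 \<Rightarrow> complex^'n^'n"
  assumes "\<rho> \<in> hom SU3 unitary_group" "CARD('n) = 1"
  shows "trivial_representation \<rho>"
proof -
  interpret S: group SU3 by (rule group_SU3)
  have mult: "\<rho> (A ** B) = \<rho> A ** \<rho> B" if "A \<in> carrier SU3" "B \<in> carrier SU3" for A B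
    using assms(1) that by (auto simp: hom_def SU3_def unitary_group_def)
  have closed: "A ** B \<in> carrier SU3" if "A \<in> carrier SU3" "B \<in> carrier SU3" for A B
    using S.m_closed[OF that] by (simp add: SU3_def)
  have square: "\<rho> (X ** X) = mat 1" if "X \<in> carrier SU3" "J \<in> carrier SU3" "X ** J ** X = J" for X J
  proof -
    have inv: "\<rho> J ** hermitian_adjoint (\<rho> J) = mat 1"
      using assms(1) that(2) by (auto simp: hom_def unitary_group_def)
    have "\<rho> J = \<rho> X ** \<rho> J ** \<rho> X"
      using that mult closed by metis
    also have "\<dots> = \<rho> (X ** X) ** \<rho> J"
      using that mult matrix_mul_assoc matrix_mult_commute_dim_1[OF assms(2)] by metis
    finally have "\<rho> J ** hermitian_adjoint (\<rho> J) = \<rho> (X ** X) ** (\<rho> J ** hermitian_adjoint (\<rho> J))"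
      by (metis matrix_mul_assoc)
    then show ?thesis
      by (simp add: inv)
  qed
  \<comment> \<open>Each embedded SU(2) element is a square X^2, and an orthogonal pure quaternion J
    with X J X = J exists, so \<open>square\<close> applies.\<close>
  have SU2: "\<rho> (SU2_lower a b) = mat 1" "\<rho> (SU2_upper a b) = mat 1" if ab: "a * cnj a + b * cnj b = 1" for a b
  proof -
    obtain c d where cd: "c * cnj c + d * cnj d = 1" "c * c - d * cnj d = a" "d * cnj c + c * d = b"
      using SU2_square_root[OF ab] by blast
    obtain u where u: "u * cnj u = 1" "d * cnj u + u * cnj d = 0"
      using SU2_anticommuting by blast
    show "\<rho> (SU2_lower a b) = mat 1"
      using square[OF _ _ SU2_inverting(1)[OF cd(1) u(2)]] SU2_in_SU3(1) cd u
      by (simp add: SU2_mult)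
    show "\<rho> (SU2_upper a b) = mat 1"
      using square[OF _ _ SU2_inverting(2)[OF cd(1) u(2)]] SU2_in_SU3(2) cd u
      by (simp add: SU2_mult)
  qed
  have strip: "\<rho> (SU2_lower a b ** A) = \<rho> A" "\<rho> (SU2_upper a b ** A) = \<rho> A"
    "SU2_lower a b ** A \<in> carrier SU3" "SU2_upper a b ** A \<in> carrier SU3"
    if "a * cnj a + b * cnj b = 1" "A \<in> carrier SU3" for a b A
    using that SU2 SU2_in_SU3 mult closed by simp_all
  show ?thesis
    unfolding trivial_representation_def
  proof
    fix A assume A: "A \<in> carrier SU3"
    obtain a b where ab: "a * cnj a + b * cnj b = 1" "a * A $ 3 $ 1 = b * A $ 2 $ 1"
      using SU2_rotate_to_axis by blast
    \<comment> \<open>The first rotation, on rows 2 and 3, clears entry (3, 1).\<close>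
    define B where "B = SU2_lower a b ** A"
    have B: "B \<in> carrier SU3" "\<rho> B = \<rho> A" "B $ 3 $ 1 = 0"
      using strip[OF ab(1) A] ab(2)
      by (simp_all add: B_def) (simp add: SU2_lower_def matrix_matrix_mult_def sum_3)
    obtain c d where cd: "c * cnj c + d * cnj d = 1" "c * B $ 2 $ 1 = d * B $ 1 $ 1"
      using SU2_rotate_to_axis by blast
    \<comment> \<open>Acting on rows 1 and 2, this clears entry (2, 1) and leaves row 3
      unchanged.\<close>
    define C where "C = SU2_upper c d ** B"
    have C: "C \<in> carrier SU3" "\<rho> C = \<rho> A" "C $ 2 $ 1 = 0" "C $ 3 $ 1 = 0"
      using strip[OF cd(1) B(1)] cd(2) B(2,3)
      by (simp_all add: C_def) (simp_all add: SU2_upper_def matrix_matrix_mult_def sum_3)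
    obtain e f where ef: "e * cnj e + f * cnj f = 1" "e * C $ 3 $ 2 = f * C $ 2 $ 2"
      using SU2_rotate_to_axis by blast
    \<comment> \<open>Rows 2 and 3 already vanish in column 1, so rotating them to clear entry (3,
      2) preserves those zeros.\<close>
    define D where "D = SU2_lower e f ** C"
    have D: "D \<in> carrier SU3" "\<rho> D = \<rho> A" "D $ 2 $ 1 = 0" "D $ 3 $ 1 = 0" "D $ 3 $ 2 = 0"
      using strip[OF ef(1) C(1)] ef(2) C(2-)
      by (simp_all add: D_def) (simp_all add: SU2_lower_def matrix_matrix_mult_def sum_3)
    obtain x y where "x * cnj x = 1" "y * cnj y = 1" "D = SU2_upper x 0 ** SU2_lower y 0"
      using upper_triangular_SU3 D by metis
    then have "\<rho> D = mat 1"
      using strip(2)[of x 0 "SU2_lower y 0"] SU2(1)[of y 0] SU2_in_SU3(1)[of y 0] by simp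
    with D(2) show "\<rho> A = mat 1"
      by simp
  qed
qed

theorem proposition3p13:
  fixes K :: "(complex^3^3) set"
    and \<mu> :: "(complex^3^3) set measure"
    and \<rho> :: "complex^3^3 \<Rightarrow> complex^'n^'n"
    and W :: "complex^'n^'n \<Rightarrow> (complex^3^3) set \<Rightarrow> complex"
  assumes "K = CP2_isotropy \<or> K = diagonal_torus"
    and "invariant_probability K \<mu>"
    and "unitary_representation \<rho>"
    and "irreducible_representation \<rho>"
    and "\<not> trivial_representation \<rho>"
    and "symbol_correspondence K \<mu> \<rho> W"
    and "mapping_positive K W"
  shows "\<not> Stratonovich_Weyl \<mu> W"
proof
  assume "Stratonovich_Weyl \<mu> W"
  then have "CARD('n) = 1"
    using Stratonovich_Weyl_positive_dim_1 assms by blast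
  then have "trivial_representation \<rho>"
    using assms(3) unfolding unitary_representation_def by (intro dim_1_representation_trivial) auto
  with assms(5) show False
    by simp
qed

end
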